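(* Let $G$ be a directed graph with positive edge weights. Suppose that for every set $S$ of 11 nodes of $G$ there is a shortest path in $G$ containing every node of $S$. Then there exists a pair $(s,t)$ of nodes of $G$ such that the union of some shortest $st$-path and some shortest $ts$-path contains every node of $G$.
   Context: A shortest path is a directed path from some node $u$ to some node $v$ whose total weight equals the directed shortest-path distance $\mathrm{dist}(u,v)$; "a shortest path containing every node of $S$" means a shortest path between some pair of nodes whose node set includes $S$.
   Formalization: G is assumed finite with at least 11 nodes, and if t cannot reach s the missing ts-path counts as empty (one shortest st-path then contains every node); the literal claim fails for the bi-infinite directed line, a bidirected 3-leaf star and a one-way path. *)

theory Defs
  imports "Graph_Theory.Graph_Theory"
begin

(* \<mu> is the directed distance with values in ereal; it is infinite when v is not
   reachable from u, so in that case no p is a shortest path from u to v.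
   For s = t the empty arc list is the (only) shortest path, with vertex set {s}. *)
definition (in wf_digraph) shortest_path :: "'b weight_fun \<Rightarrow> 'a \<Rightarrow> 'b awalk \<Rightarrow> 'a \<Rightarrow> bool"
  where "shortest_path w u p v \<longleftrightarrow> apath u p v \<and> ereal (awalk_cost w p) = \<mu> w u v"

definition (in wf_digraph) path_nodes :: "'a \<Rightarrow> 'b awalk \<Rightarrow> 'a set"
  where "path_nodes u p = set (awalk_verts u p)"

end

theory Submission
  imports Defs
begin

text \<open>
  Choose \<open>s\<close>, \<open>t\<close> maximising the round trip \<open>dist(s,t) + dist(t,s)\<close>. Closing up a shortest path
  through \<open>s\<close> and \<open>t\<close> gives a tour as long as the round trip between its two ends, so by maximality
  it splits into a geodesic from \<open>s\<close> to \<open>t\<close> and one from \<open>t\<close> to \<open>s\<close>. If \<open>s\<close> comes before \<open>t\<close> on the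
  path, then all nodes of the path lying metrically between \<open>s\<close> and \<open>t\<close> are on the first geodesic.
  Hence the interval \<open>I(s,t)\<close> or the interval \<open>I(t,s)\<close> is entirely geodesic: otherwise a bad pair from
  each, together with \<open>s\<close> and \<open>t\<close>, would be six nodes on no shortest path. If it is \<open>I(s,t)\<close>, the same
  argument shows that the nodes outside \<open>I(s,t)\<close> form a geodesic from \<open>t\<close> to \<open>s\<close>.
  Unreachable pairs are handled by giving them one large finite distance \<open>M\<close>.
\<close>

section \<open>Geodesic sets in finite quasi-metric spaces\<close>

text \<open>\<open>p\<close> is the position along the geodesic.\<close>
definition geodesic :: "('a \<Rightarrow> 'a \<Rightarrow> real) \<Rightarrow> ('a \<Rightarrow> real) \<Rightarrow> 'a set \<Rightarrow> bool" where
  "geodesic d p S \<longleftrightarrow> (\<forall>x\<in>S. \<forall>y\<in>S. p x \<le> p y \<longrightarrow> d x y = p y - p x)"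

lemma geodesicD: "geodesic d p S \<Longrightarrow> x \<in> S \<Longrightarrow> y \<in> S \<Longrightarrow> p x \<le> p y \<Longrightarrow> d x y = p y - p x"
  by (auto simp: geodesic_def)

lemma geodesic_subset: "geodesic d p S \<Longrightarrow> T \<subseteq> S \<Longrightarrow> geodesic d p T"
  by (auto simp: geodesic_def)

lemma not_geodesicE:
  assumes "\<not> geodesic d p S"
  obtains x y where "x \<in> S" "y \<in> S" "\<not> geodesic d p {x, y}"
proof -
  obtain x y where "x \<in> S" "y \<in> S" "p x \<le> p y" "d x y \<noteq> p y - p x"
    using assms unfolding geodesic_def by metis
  then show thesis using that[of x y] geodesicD[of d p "{x, y}" x y] by auto
qed

locale finite_quasimetric =
  fixes V :: "'a set" and d :: "'a \<Rightarrow> 'a \<Rightarrow> real"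
  assumes finite_V: "finite V"
    and d_refl: "x \<in> V \<Longrightarrow> d x x = 0"
    and d_pos: "x \<in> V \<Longrightarrow> y \<in> V \<Longrightarrow> x \<noteq> y \<Longrightarrow> 0 < d x y"
    and d_triangle: "x \<in> V \<Longrightarrow> y \<in> V \<Longrightarrow> z \<in> V \<Longrightarrow> d x z \<le> d x y + d y z"
begin

section \<open>Metric intervals and pairs of maximal round trip\<close>

definition between :: "'a \<Rightarrow> 'a \<Rightarrow> 'a set" where
  "between s t = {x \<in> V. d s x + d x t = d s t}"

text \<open>A diametral pair for the symmetrised distance \<open>d x y + d y x\<close>.\<close>

definition antipodal :: "'a \<Rightarrow> 'a \<Rightarrow> bool" where
  "antipodal s t \<longleftrightarrow> s \<in> V \<and> t \<in> V \<and> s \<noteq> t \<and> (\<forall>x\<in>V. \<forall>y\<in>V. d x y + d y x \<le> d s t + d t s)"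

lemma antipodal_sym: "antipodal s t \<Longrightarrow> antipodal t s"
  by (auto simp: antipodal_def add.commute)

lemma d_nonneg: "x \<in> V \<Longrightarrow> y \<in> V \<Longrightarrow> 0 \<le> d x y"
  using d_refl d_pos by (cases "x = y") (auto simp: less_imp_le)

lemma ends_between: "s \<in> V \<Longrightarrow> t \<in> V \<Longrightarrow> s \<in> between s t \<and> t \<in> between s t"
  by (auto simp: between_def d_refl)

lemma ex_antipodal:
  assumes "a \<in> V" "b \<in> V" "a \<noteq> b"
  shows "\<exists>s t. antipodal s t"
proof -
  let ?c = "\<lambda>(x, y). d x y + d y x"
  have "finite (V \<times> V)" "V \<times> V \<noteq> {}" using finite_V assms by auto
  then have "Max (?c ` (V \<times> V)) \<in> ?c ` (V \<times> V)" by (intro Max_in) auto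
  then obtain z where "z \<in> V \<times> V" "?c z = Max (?c ` (V \<times> V))" by auto
  then have z: "z \<in> V \<times> V" "\<forall>y\<in>V \<times> V. ?c y \<le> ?c z"
    using \<open>finite (V \<times> V)\<close> by (simp_all del: split_paired_All)
  obtain s t where st: "z = (s, t)" by force
  \<comment> \<open>The maximum is at least this positive value, while a pair with equal entries has
    round trip 0.\<close>
  have "0 < d a b + d b a" using assms d_pos by (simp add: add_pos_pos)
  also have "\<dots> \<le> d s t + d t s" using z assms st by auto
  finally have "s \<noteq> t" using z st d_refl by auto
  then show ?thesis using z st by (auto simp: antipodal_def)
qed

section \<open>Splitting a geodesic at an antipodal pair\<close>

lemma between_position:
  assumes "geodesic d p S" "S \<subseteq> V" "s \<in> S" "t \<in> S" "x \<in> S" "p s < p t" "x \<in> between s t"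
  shows "p s \<le> p x" "p x \<le> p t"
proof -
  have V: "s \<in> V" "t \<in> V" "x \<in> V" using assms by auto
  have st: "d s t = p t - p s" using assms by (intro geodesicD) auto
  have sxt: "d s x + d x t = d s t" using assms by (auto simp: between_def)
  \<comment> \<open>A node positioned before \<open>s\<close> would be farther from \<open>t\<close>
    than \<open>s\<close> is, and one positioned after \<open>t\<close> farther from
    \<open>s\<close> than \<open>t\<close> is. Betweenness forbids both.\<close>
  show "p s \<le> p x"
  proof (rule ccontr)
    assume "\<not> p s \<le> p x"
    then have "d x t = p t - p x" using assms by (intro geodesicD) auto
    then show False using st sxt d_nonneg[OF V(1,3)] \<open>\<not> p s \<le> p x\<close> by linarith
  qed
  show "p x \<le> p t"
  proof (rule ccontr)
    assume "\<not> p x \<le> p t"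
    then have "d s x = p x - p s" using assms by (intro geodesicD) auto
    then show False using st sxt d_nonneg[OF V(3,2)] \<open>\<not> p x \<le> p t\<close> by linarith
  qed
qed

text \<open>On these nodes \<open>d s\<close> is \<open>p\<close> shifted by the constant
  \<open>p s\<close>. The gain is a position function that no longer depends on \<open>S\<close>, so
  that information from different small sets can be combined.\<close>

lemma geodesic_between:
  assumes "geodesic d p S" "S \<subseteq> V" "s \<in> S" "t \<in> S" "p s < p t"
  shows "geodesic d (d s) (S \<inter> between s t)"
proof -
  have "d s x = p x - p s" if "x \<in> S \<inter> between s t" for x
    using between_position[OF assms(1-4) _ assms(5), of x] that assms by (intro geodesicD) auto
  then show ?thesis using assms(1) by (auto simp: geodesic_def)
qed

text \<open>Going from the first node \<open>u\<close> of \<open>S\<close> to the last node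
  \<open>v\<close> and back to \<open>u\<close> is a closed tour. By maximality its arc from
  \<open>t\<close> over \<open>v\<close> and \<open>u\<close> to \<open>s\<close> is no longer than
  \<open>d t s\<close>, hence is itself geodesic. The nodes outside \<open>between s t\<close> come
  after \<open>t\<close> or before \<open>s\<close>, so they all lie on this arc.\<close>

lemma geodesic_outside:
  assumes geo: "geodesic d p S" and SV: "S \<subseteq> V" and st: "s \<in> S" "t \<in> S" "p s < p t"
    and anti: "antipodal s t"
  shows "S - between s t \<subseteq> between t s" "geodesic d (d t) (S - between s t)"
proof -
  have "finite S" using SV finite_V finite_subset by blast
  then have fin: "finite (p ` S)" "p ` S \<noteq> {}" using st by auto
  obtain u where "u \<in> S" "p u = Min (p ` S)" using Min_in[OF fin] by auto
  then have u: "u \<in> S" "\<And>x. x \<in> S \<Longrightarrow> p u \<le> p x" using fin by simp_all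
  obtain v where "v \<in> S" "p v = Max (p ` S)" using Max_in[OF fin] by auto
  then have v: "v \<in> S" "\<And>x. x \<in> S \<Longrightarrow> p x \<le> p v" using fin by simp_all
  have inV: "x \<in> V" if "x \<in> S" for x using that SV by auto
  note gd = geodesicD[OF geo]
  have "p u < p v" using u(2)[OF st(1)] v(2)[OF st(2)] st(3) by linarith
  then have vu: "0 < d v u" using d_pos[of v u] u v inV by auto
  have "d u v + d v u \<le> d s t + d t s" using anti u v inV by (auto simp: antipodal_def)
  moreover have "d u v = p v - p u" "d s t = p t - p s" using u v st gd by auto
  \<comment> \<open>The right-hand side is the length of the arc from \<open>t\<close> over
    \<open>v\<close> and \<open>u\<close> to \<open>s\<close>.\<close>
  ultimately have ts: "d t s \<ge> (p v - p t) + d v u + (p s - p u)" by linarith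
  \<comment> \<open>This bounds a distance by the detour that runs forward to \<open>v\<close>,
    jumps to \<open>u\<close> and runs forward again.\<close>
  have jump: "d x y \<le> (p v - p x) + d v u + (p y - p u)" if "x \<in> S" "y \<in> S" for x y
  proof -
    have "d x y \<le> d x v + d v y" "d v y \<le> d v u + d u y"
      using that u v inV by (auto intro!: d_triangle)
    moreover have "d x v = p v - p x" "d u y = p y - p u" using that u v gd by auto
    ultimately show ?thesis by linarith
  qed
  have tri: "d x z \<le> d x y + d y z" if "x \<in> S" "y \<in> S" "z \<in> S" for x y z
    using that inV d_triangle by auto
  have cases: "p t < p x \<or> p x < p s" if "x \<in> S - between s t" for x
  proof (rule ccontr)
    assume "\<not> ?thesis"
    then have "d s x = p x - p s" "d x t = p t - p x" "d s t = p t - p s"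
      using that st gd by auto
    then show False using that inV by (auto simp: between_def)
  qed
  \<comment> \<open>The upper bounds on the two legs add up to at most the lower bound
    \<open>ts\<close> for \<open>d t s\<close>, so the triangle inequality makes them all
    equalities; likewise for nodes before \<open>s\<close>.\<close>
  have after: "d t x = p x - p t \<and> d t x + d x s = d t s" if "x \<in> S" "p t < p x" for x
    using gd[OF st(2) that(1)] that jump[OF that(1) st(1)] ts tri[OF st(2) that(1) st(1)] by linarith
  have before: "d t x = (p v - p t) + d v u + (p x - p u) \<and> d t x + d x s = d t s"
    if "x \<in> S" "p x < p s" for x
    using gd[OF that(1) st(1)] that jump[OF st(2) that(1)] ts tri[OF st(2) that(1) st(1)] by linarith
  show "S - between s t \<subseteq> between t s"
    using cases after before inV by (force simp: between_def)
  show "geodesic d (d t) (S - between s t)"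
    unfolding geodesic_def
  proof (intro ballI impI)
    fix x y
    assume x: "x \<in> S - between s t" and y: "y \<in> S - between s t" and le: "d t x \<le> d t y"
    then have S: "x \<in> S" "y \<in> S" by auto
    show "d x y = d t y - d t x"
      using cases[OF x] cases[OF y]
    proof (elim disjE)
      assume "p t < p x" "p t < p y"
      then show ?thesis using after[of x] after[of y] le S gd by auto
    next
      assume "p x < p s" "p y < p s"
      then show ?thesis using before[of x] before[of y] le S gd by auto
    next
      \<comment> \<open>The detour bounds \<open>d x y\<close> from above, the triangle inequality
        through \<open>x\<close> bounds it from below, and the two bounds agree.\<close>
      assume "p t < p x" "p y < p s"
      then show ?thesis
        using after[of x] before[of y] S jump[OF S] tri[OF st(2) S] by linarith
    next
      \<comment> \<open>Impossible: on the arc from \<open>t\<close>, \<open>y\<close> comes before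
        the jump of length \<open>d v u > 0\<close> and \<open>x\<close> after it, contrary to
        \<open>le\<close>.\<close>
      assume "p x < p s" "p t < p y"
      then show ?thesis
        using before[of x] after[of y] S le vu v(2)[OF S(2)] u(2)[OF S(1)] by linarith
    qed
  qed
qed

section \<open>Covering the space by two geodesics\<close>

lemma geodesic_insert_ends:
  assumes "geodesic d (d s) A" "A \<subseteq> between s t" "s \<in> V" "t \<in> V"
  shows "geodesic d (d s) (insert s (insert t A))"
proof -
  have b: "x \<in> V" "d s x + d x t = d s t" if "x \<in> A" for x
    using assms that by (auto simp: between_def)
  \<comment> \<open>By positivity of \<open>d\<close>, only \<open>s\<close> has position 0, and
    within the interval only \<open>t\<close> has position \<open>d s t\<close>. So the cases with
    an end in the wrong place collapse to equality.\<close>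
  have sm: "x = s" if "x \<in> V" "d s x \<le> 0" for x using d_pos[of s x] that assms by force
  have tm: "x = t" if "x \<in> V" "d s t \<le> d s x" "d s x + d x t = d s t" for x
    using d_pos[of x t] that assms by force
  show ?thesis
    unfolding geodesic_def
  proof (intro ballI impI)
    fix x y
    assume x: "x \<in> insert s (insert t A)" and y: "y \<in> insert s (insert t A)"
      and le: "d s x \<le> d s y"
    have V: "x \<in> V" "y \<in> V" using x y assms b by auto
    consider "x = y" | "x = s" | "y = s" | "x = t" | "y = t" | "x \<in> A" "y \<in> A"
      using x y by blast
    then show "d x y = d s y - d s x"
    proof cases
      case 1 then show ?thesis using V d_refl by simp
    next
      case 2 then show ?thesis using assms d_refl by simp
    next
      case 3
      then have "x = s" using sm V le assms d_refl by auto
      then show ?thesis using assms d_refl by simp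
    next
      case 4
      then have "d s y + d y t = d s t" using y b assms d_refl le by auto
      then have "y = t" using tm V le 4 by auto
      then show ?thesis using 4 assms d_refl by simp
    next
      case 5
      then have "d s x + d x t = d s t" using x b assms d_refl by auto
      then show ?thesis using 5 by simp
    next
      case 6 then show ?thesis using assms(1) le by (auto simp: geodesic_def)
    qed
  qed
qed

text \<open>Once the position functions are fixed as \<open>d s\<close> and \<open>d t\<close>,
  failure to be geodesic is witnessed by two nodes. Two such witnesses together with
  \<open>s\<close> and \<open>t\<close> explain the bound 6. One of the two sets is a whole
  interval, the other its complement with the ends added.\<close>

theorem geodesic_cover:
  assumes anti: "antipodal s t"
    and six: "\<And>S. S \<subseteq> V \<Longrightarrow> card S \<le> 6 \<Longrightarrow> \<exists>p. geodesic d p S"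
  shows "\<exists>A B. A \<union> B = V \<and> {s, t} \<subseteq> A \<and> {s, t} \<subseteq> B \<and> A \<subseteq> between s t \<and> B \<subseteq> between t s \<and>
    geodesic d (d s) A \<and> geodesic d (d t) B"
proof -
  have stV: "s \<in> V" "t \<in> V" "s \<noteq> t" using anti by (auto simp: antipodal_def)
  have order: "p s < p t \<or> p t < p s" if "geodesic d p S" "s \<in> S" "t \<in> S" for p S
    using geodesicD[OF that] d_pos[of s t] stV by force
  have half: "\<exists>B. between a b \<union> B = V \<and> {a, b} \<subseteq> B \<and> B \<subseteq> between b a \<and> geodesic d (d b) B"
    if ab: "antipodal a b" "{a, b} = {s, t}" and g: "geodesic d (d a) (between a b)" for a b
  proof -
    have abV: "a \<in> V" "b \<in> V" using ab by (auto simp: antipodal_def)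
    have pair: "{x, y} - between a b \<subseteq> between b a \<and> geodesic d (d b) ({x, y} - between a b)"
      if xy: "x \<in> V" "y \<in> V" for x y
    proof -
      let ?S = "{a, b, x, y}"
      have S: "?S \<subseteq> V" "a \<in> ?S" "b \<in> ?S" using abV xy by auto
      have "card ?S \<le> 6" using card_length[of "[a, b, x, y]"] by simp
      then obtain p where p: "geodesic d p ?S" using six S by blast
      have "p a < p b \<or> p b < p a" using order[OF p] ab(2) by (auto simp: doubleton_eq_iff)
      then show ?thesis
      proof
        assume "p a < p b"
        from geodesic_outside[OF p S this ab(1)] show ?thesis
          by (auto intro: geodesic_subset)
      next
        \<comment> \<open>Here the path visits \<open>b\<close> first, so every node of
          \<open>?S\<close> missing from \<open>between b a\<close> is in
          \<open>between a b\<close>. Hence the nodes outside \<open>between a b\<close> lie in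
          \<open>between b a\<close>, where \<open>d b\<close> measures position.\<close>
        assume lt: "p b < p a"
        have "?S - between b a \<subseteq> between a b"
          using geodesic_outside(1)[OF p S(1,3,2) lt antipodal_sym[OF ab(1)]] .
        then have "{x, y} - between a b \<subseteq> ?S \<inter> between b a" by blast
        with geodesic_between[OF p S(1,3,2) lt] show ?thesis
          by (meson geodesic_subset inf.boundedE)
      qed
    qed
    let ?B = "V - between a b"
    have B: "?B \<subseteq> between b a" using pair by blast
    have "geodesic d (d b) ?B"
    proof (rule ccontr)
      assume "\<not> ?thesis"
      then obtain x y where "x \<in> ?B" "y \<in> ?B" "\<not> geodesic d (d b) {x, y}"
        by (rule not_geodesicE)
      moreover have "{x, y} - between a b = {x, y}" using calculation by auto
      ultimately show False using pair[of x y] by auto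
    qed
    \<comment> \<open>The complement of the interval omits \<open>a\<close> and \<open>b\<close>;
      they return as the ends of the second geodesic.\<close>
    then have "geodesic d (d b) (insert b (insert a ?B))"
      using B abV by (intro geodesic_insert_ends)
    moreover have "between a b \<subseteq> V" by (auto simp: between_def)
    ultimately show ?thesis
      using B abV ends_between by (intro exI[of _ "insert b (insert a ?B)"]) auto
  qed
  have "geodesic d (d s) (between s t) \<or> geodesic d (d t) (between t s)"
  proof (rule ccontr)
    assume "\<not> ?thesis"
    then obtain x y x' y' where
      xy: "x \<in> between s t" "y \<in> between s t" "\<not> geodesic d (d s) {x, y}" and
      xy': "x' \<in> between t s" "y' \<in> between t s" "\<not> geodesic d (d t) {x', y'}"
      by (metis not_geodesicE)
    let ?S = "{s, t, x, y, x', y'}"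
    have S: "?S \<subseteq> V" "s \<in> ?S" "t \<in> ?S" using stV xy xy' by (auto simp: between_def)
    have "card ?S \<le> 6" using card_length[of "[s, t, x, y, x', y']"] by simp
    then obtain p where p: "geodesic d p ?S" using six S by blast
    from order[OF p S(2,3)] show False
    proof
      assume "p s < p t"
      from geodesic_between[OF p S this] have "geodesic d (d s) {x, y}"
        by (rule geodesic_subset) (use xy in auto)
      then show False using xy by simp
    next
      assume "p t < p s"
      from geodesic_between[OF p S(1,3,2) this] have "geodesic d (d t) {x', y'}"
        by (rule geodesic_subset) (use xy' in auto)
      then show False using xy' by simp
    qed
  qed
  then show ?thesis
  proof
    assume g: "geodesic d (d s) (between s t)"
    from half[OF anti refl g] g show ?thesis using ends_between stV by blast
  next
    assume g: "geodesic d (d t) (between t s)"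
    from half[OF antipodal_sym[OF anti] _ g] obtain B where
      B: "between t s \<union> B = V" "{t, s} \<subseteq> B" "B \<subseteq> between s t" "geodesic d (d s) B" by blast
    have "{s, t} \<subseteq> between t s" using ends_between[of t s] stV by simp
    then show ?thesis using B g
      by - (rule exI[of _ B], rule exI[of _ "between t s"], simp add: Un_commute)
  qed
qed

end

section \<open>Shortest paths and geodesic sets\<close>

context fin_digraph
begin

section \<open>Distances under positive edge weights\<close>

lemma mu_refl:
  assumes "\<forall>e \<in> arcs G. 0 < w e" "u \<in> verts G"
  shows "\<mu> w u u = 0"
proof (rule antisym)
  have "awalk u [] u" using assms by (simp add: awalk_Nil_iff)
  from min_cost_le_walk_cost[OF this, of w] show "\<mu> w u u \<le> 0"
    by (simp add: zero_ereal_def)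
  show "0 \<le> \<mu> w u u" unfolding \<mu>_def
    using assms by (auto intro!: INF_greatest pos_cost_pos_awalk_cost simp: less_imp_le)
qed

lemma awalk_cost_pos:
  assumes "\<forall>e \<in> arcs G. 0 < w e" "awalk u p v" "p \<noteq> []"
  shows "0 < awalk_cost w p"
proof (cases p)
  case (Cons e q)
  then have "awalk (head G e) q v" "e \<in> arcs G" using assms by (auto simp: awalk_Cons_iff)
  then have "0 \<le> awalk_cost w q" "0 < w e"
    using assms by (auto intro!: pos_cost_pos_awalk_cost simp: less_imp_le)
  then show ?thesis using Cons by simp
qed (use assms in simp)

lemma ex_shortest_path:
  assumes "\<forall>e \<in> arcs G. 0 < w e" "u \<rightarrow>\<^sup>* v"
  obtains p where "shortest_path w u p v"
proof -
  have "\<exists>p. apath u p v \<and> \<mu> w u v = awalk_cost w p"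
    using assms by (intro min_cost_awalk) (auto simp: less_imp_le)
  then show thesis using that by (auto simp: shortest_path_def)
qed

lemma mu_real:
  assumes "\<forall>e \<in> arcs G. 0 < w e" "u \<rightarrow>\<^sup>* v"
  shows "\<mu> w u v = ereal (real_of_ereal (\<mu> w u v))"
proof -
  obtain p where "shortest_path w u p v" using ex_shortest_path[OF assms] .
  then have "ereal (awalk_cost w p) = \<mu> w u v" by (simp add: shortest_path_def)
  from this[symmetric] show ?thesis by simp
qed

lemma mu_triangle:
  assumes "\<forall>e \<in> arcs G. 0 < w e" "u \<rightarrow>\<^sup>* v" "v \<rightarrow>\<^sup>* x"
  shows "\<mu> w u x \<le> \<mu> w u v + \<mu> w v x"
proof -
  obtain p q where pq: "shortest_path w u p v" "shortest_path w v q x"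
    using ex_shortest_path assms by metis
  then have "awalk u (p @ q) x" by (auto simp: shortest_path_def apath_def intro: awalk_appendI)
  from min_cost_le_walk_cost[OF this, of w] pq show ?thesis
    by (metis awalk_cost_append plus_ereal.simps(1) shortest_path_def)
qed

lemma mu_pos:
  assumes "\<forall>e \<in> arcs G. 0 < w e" "u \<noteq> v"
  shows "0 < \<mu> w u v"
proof (cases "u \<rightarrow>\<^sup>* v")
  case True
  then obtain p where p: "shortest_path w u p v" using ex_shortest_path assms by metis
  then have "awalk u p v" "p \<noteq> []" using assms by (auto simp: shortest_path_def apath_def awalk_Nil_iff)
  from awalk_cost_pos[OF assms(1) this] p show ?thesis
    by (metis ereal_less(2) shortest_path_def)
qed (simp add: shortest_path_inf)

text \<open>A repeated node would enclose a closed subwalk of positive cost, and deleting it would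
  leave a walk cheaper than the distance.\<close>

lemma shortest_walk_is_path:
  assumes "\<forall>e \<in> arcs G. 0 < w e" "awalk u p v" "ereal (awalk_cost w p) = \<mu> w u v"
  shows "shortest_path w u p v"
proof -
  have "distinct (awalk_verts u p)"
  proof (rule ccontr)
    assume "\<not> ?thesis"
    from awalk_not_distinct_decomp[OF assms(2) this] obtain q r z x where
      qrz: "p = q @ r @ z" "0 < length r" "awalk u q x" "awalk x r x" "awalk x z v" by auto
    then have "0 < awalk_cost w r" using awalk_cost_pos assms(1) by auto
    moreover have "awalk u (q @ z) v" using qrz by (auto intro: awalk_appendI)
    from min_cost_le_walk_cost[OF this, of w] have "awalk_cost w p \<le> awalk_cost w (q @ z)"
      by (simp add: assms(3)[symmetric])
    ultimately show False using qrz by simp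
  qed
  then show ?thesis using assms by (simp add: shortest_path_def apath_def)
qed

section \<open>Passing between shortest paths and geodesic sets\<close>

lemma shortest_path_positions:
  assumes pos: "\<forall>e \<in> arcs G. 0 < w e" and p: "shortest_path w u p v"
    and xy: "x \<in> path_nodes u p" "y \<in> path_nodes u p"
    and le: "\<mu> w u x \<le> \<mu> w u y"
  shows "x \<rightarrow>\<^sup>* y" "\<mu> w x y = ereal (real_of_ereal (\<mu> w u y) - real_of_ereal (\<mu> w u x))"
proof -
  have walk: "awalk u p v" and cost: "ereal (awalk_cost w p) = \<mu> w u v"
    using p by (auto simp: shortest_path_def apath_def)
  \<comment> \<open>Segments of a shortest path are shortest: each cost bounds a distance from
    above, and the triangle inequality with optimality of the whole path forces equality.\<close>
  have ordered: "\<mu> w u a = awalk_cost w q1 \<and> \<mu> w a b = awalk_cost w q2 \<and>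
      \<mu> w u b = awalk_cost w q1 + awalk_cost w q2"
    if q: "p = q1 @ q2 @ q3" "awalk u q1 a" "awalk a q2 b" "awalk b q3 v" for q1 q2 q3 a b
  proof -
    have r: "u \<rightarrow>\<^sup>* a" "a \<rightarrow>\<^sup>* b" "b \<rightarrow>\<^sup>* v" "u \<rightarrow>\<^sup>* b"
      using q reachable_trans by (auto simp: reachable_awalk intro: awalk_appendI)
    note re = r[THEN mu_real[OF pos]]
    have t: "\<mu> w u b \<le> \<mu> w u a + \<mu> w a b" "\<mu> w u v \<le> \<mu> w u b + \<mu> w b v"
      using mu_triangle[OF pos] r by auto
    have l: "\<mu> w u a \<le> awalk_cost w q1" "\<mu> w a b \<le> awalk_cost w q2" "\<mu> w b v \<le> awalk_cost w q3"
      using min_cost_le_walk_cost q by auto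
    have c: "\<mu> w u v = ereal (awalk_cost w q1 + awalk_cost w q2 + awalk_cost w q3)"
      using cost q by (simp add: add.assoc)
    obtain m1 m2 m3 m4 where m: "\<mu> w u a = ereal m1" "\<mu> w a b = ereal m2" "\<mu> w b v = ereal m3"
      "\<mu> w u b = ereal m4" using re by metis
    show ?thesis using t l c unfolding m by simp
  qed
  have "(\<exists>q1 q2 q3. p = q1 @ q2 @ q3 \<and> awalk u q1 x \<and> awalk x q2 y \<and> awalk y q3 v) \<or>
        (\<exists>q1 q2 q3. p = q1 @ q2 @ q3 \<and> awalk u q1 y \<and> awalk y q2 x \<and> awalk x q3 v)"
  proof -
    obtain q r where qr: "p = q @ r" "awalk u q x" "awalk x r v"
      using awalk_decomp[OF walk] xy(1) unfolding path_nodes_def by metis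
    then have "y \<in> set (awalk_verts u q) \<or> y \<in> set (awalk_verts x r)"
      using xy(2) set_awalk_verts_append[OF qr(2,3)] unfolding path_nodes_def by blast
    then show ?thesis
    proof
      assume "y \<in> set (awalk_verts u q)"
      from awalk_decomp[OF qr(2) this] show ?thesis using qr(1,3) by (metis append.assoc)
    next
      assume "y \<in> set (awalk_verts x r)"
      from awalk_decomp[OF qr(3) this] show ?thesis using qr(1,2) by metis
    qed
  qed
  then have "x \<rightarrow>\<^sup>* y \<and> \<mu> w x y = ereal (real_of_ereal (\<mu> w u y) - real_of_ereal (\<mu> w u x))"
  proof (elim disjE exE conjE)
    fix q1 q2 q3 assume q: "p = q1 @ q2 @ q3" "awalk u q1 x" "awalk x q2 y" "awalk y q3 v"
    then show ?thesis using ordered[OF q] by (auto simp: reachable_awalk)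
  next
    fix q1 q2 q3 assume q: "p = q1 @ q2 @ q3" "awalk u q1 y" "awalk y q2 x" "awalk x q3 v"
    \<comment> \<open>If \<open>y\<close> precedes \<open>x\<close> on the path, \<open>le\<close>
      leaves no positive cost between them, so they coincide.\<close>
    have "awalk_cost w q2 \<le> 0" using le ordered[OF q] by simp
    then have "q2 = []" using awalk_cost_pos[OF pos q(3)] by force
    then have "x = y" "x \<in> verts G" using q by (auto simp: awalk_Nil_iff)
    then show ?thesis using mu_refl[OF pos] by (auto simp: zero_ereal_def)
  qed
  then show "x \<rightarrow>\<^sup>* y" "\<mu> w x y = ereal (real_of_ereal (\<mu> w u y) - real_of_ereal (\<mu> w u x))"
    by auto
qed

text \<open>Visit \<open>A\<close> in order of position: remove \<open>t\<close>, walk to the last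
  remaining node \<open>t'\<close>, and append a shortest path from \<open>t'\<close> to
  \<open>t\<close>. The costs telescope.\<close>

lemma walk_through_geodesic:
  assumes pos: "\<forall>e \<in> arcs G. 0 < w e"
    and "finite A" "A \<subseteq> verts G"
    and "\<And>x y. x \<in> A \<Longrightarrow> y \<in> A \<Longrightarrow> f x \<le> f y \<Longrightarrow> \<mu> w x y = ereal (f y - f x)"
    and "s \<in> A" "t \<in> A" "\<And>x. x \<in> A \<Longrightarrow> f s \<le> f x \<and> f x \<le> f t"
  shows "\<exists>q. awalk s q t \<and> awalk_cost w q = f t - f s \<and> A \<subseteq> set (awalk_verts s q)"
  using assms(2-)
proof (induction "card A" arbitrary: A t rule: less_induct)
  case less
  note mu = less.prems(3)
  have inj: "x = y" if "x \<in> A" "y \<in> A" "f x = f y" for x y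
    using mu[OF that(1,2)] mu_pos[OF pos, of x y] that(3) by force
  show ?case
  proof (cases "s = t")
    case True
    then have "A \<subseteq> {s}" using less.prems(4,6) inj by (metis antisym insertI1 subsetI)
    then show ?thesis using True less.prems by (intro exI[of _ "[]"]) (auto simp: awalk_Nil_iff)
  next
    case False
    let ?A = "A - {t}"
    have fin: "finite (f ` ?A)" "f ` ?A \<noteq> {}" using less.prems False by auto
    from Max_in[OF fin] obtain t' where t': "t' \<in> ?A" "\<And>x. x \<in> ?A \<Longrightarrow> f x \<le> f t'"
      using Max_ge[OF fin(1)] by (metis imageE imageI)
    have "card ?A < card A" using less.prems by (meson card_Diff1_less)
    then have "\<exists>q. awalk s q t' \<and> awalk_cost w q = f t' - f s \<and> ?A \<subseteq> set (awalk_verts s q)"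
      by (rule less.hyps) (use less.prems t' False in auto)
    then obtain q where q: "awalk s q t'" "awalk_cost w q = f t' - f s"
      "?A \<subseteq> set (awalk_verts s q)" by blast
    have m: "\<mu> w t' t = ereal (f t - f t')" using less.prems t' by auto
    then have "t' \<rightarrow>\<^sup>* t" using \<mu>_reach_conv[of w t' t] by simp
    then obtain r where r: "shortest_path w t' r t" using ex_shortest_path pos by metis
    then have r': "awalk t' r t" "awalk_cost w r = f t - f t'"
      using m by (auto simp: shortest_path_def apath_def)
    have walk: "awalk s (q @ r) t" using q r' by (auto intro: awalk_appendI)
    have "set (awalk_verts s (q @ r)) = set (awalk_verts s q) \<union> set (awalk_verts t' r)"
      using set_awalk_verts_append[OF q(1) r'(1)] .
    moreover have "t \<in> set (awalk_verts t' r)" 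
      using awalkE[OF r'(1)] by (metis awalk_verts_non_Nil last_in_set)
    ultimately have "A \<subseteq> set (awalk_verts s (q @ r))" using q(3) by blast
    then show ?thesis using walk q r' by (intro exI[of _ "q @ r"]) auto
  qed
qed

lemma shortest_path_through_geodesic:
  assumes pos: "\<forall>e \<in> arcs G. 0 < w e"
    and "A \<subseteq> verts G"
    and mu: "\<And>x y. x \<in> A \<Longrightarrow> y \<in> A \<Longrightarrow> f x \<le> f y \<Longrightarrow> \<mu> w x y = ereal (f y - f x)"
    and st: "s \<in> A" "t \<in> A" "\<And>x. x \<in> A \<Longrightarrow> f s \<le> f x \<and> f x \<le> f t"
  shows "\<exists>q. shortest_path w s q t \<and> A \<subseteq> path_nodes s q"
proof -
  have "finite A" using assms finite_subset finite_verts by blast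
  then obtain q where q: "awalk s q t" "awalk_cost w q = f t - f s" "A \<subseteq> set (awalk_verts s q)"
    using walk_through_geodesic[OF pos _ assms(2-)] by blast
  then show ?thesis
    using shortest_walk_is_path[OF pos q(1)] mu[OF st(1,2)] st by (auto simp: path_nodes_def)
qed

lemma path_nodes_subset: "shortest_path w u p v \<Longrightarrow> path_nodes u p \<subseteq> verts G"
  by (auto simp: shortest_path_def apath_def path_nodes_def)

section \<open>Transfer to graphs, including unreachable pairs\<close>

theorem covered_by_two_shortest_paths:
  assumes pos: "\<forall>e \<in> arcs G. 0 < w e"
    and two: "2 \<le> card (verts G)"
    and six: "\<And>S. S \<subseteq> verts G \<Longrightarrow> card S \<le> 6 \<Longrightarrow>
      \<exists>u v p. shortest_path w u p v \<and> S \<subseteq> path_nodes u p"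
  shows "\<exists>s \<in> verts G. \<exists>t \<in> verts G.
    (\<exists>p q. shortest_path w s p t \<and> shortest_path w t q s \<and>
       path_nodes s p \<union> path_nodes t q = verts G) \<or>
    (\<not> t \<rightarrow>\<^sup>* s \<and> (\<exists>p. shortest_path w s p t \<and> path_nodes s p = verts G))"
proof -
  let ?V = "verts G"
  let ?m = "\<lambda>x y. real_of_ereal (\<mu> w x y)"
  \<comment> \<open>\<open>real_of_ereal\<close> sends infinity to 0, so \<open>N\<close> still
    bounds every finite distance.\<close>
  define N where "N = Max ((\<lambda>(x, y). ?m x y) ` (?V \<times> ?V))"
  have N: "?m x y \<le> N" if "x \<in> ?V" "y \<in> ?V" for x y
    unfolding N_def using that by (intro Max_ge) auto
  \<comment> \<open>\<open>M\<close> exceeds every finite distance, so between nodes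
    \<open>d x y < M\<close> expresses reachability. The triangle inequality survives because a sum
    with an unreachable leg is at least \<open>M\<close>.\<close>
  define M where "M = 2 * \<bar>N\<bar> + 1"
  define d where "d = (\<lambda>x y. if x \<rightarrow>\<^sup>* y then ?m x y else M)"
  have M: "0 < M" unfolding M_def by simp
  have m_less: "2 * ?m x y < M" if "x \<in> ?V" "y \<in> ?V" for x y
    using N[OF that] unfolding M_def by linarith
  have m_pos: "0 < ?m x y" if "x \<noteq> y" "x \<rightarrow>\<^sup>* y" for x y
    using mu_pos[OF pos that(1)] mu_real[OF pos that(2)] by (metis ereal_less(2))
  have m_refl: "?m x x = 0" if "x \<in> ?V" for x using mu_refl[OF pos that] by simp
  have m_nonneg: "0 \<le> ?m x y" if "x \<in> ?V" "x \<rightarrow>\<^sup>* y" for x y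
    using m_pos[OF _ that(2)] m_refl[OF that(1)] by (cases "x = y") auto
  interpret Q: finite_quasimetric ?V d
  proof
    show "finite ?V" by simp
    show "d x x = 0" if "x \<in> ?V" for x using that m_refl by (simp add: d_def)
    show "0 < d x y" if "x \<in> ?V" "y \<in> ?V" "x \<noteq> y" for x y
      using that m_pos M by (auto simp: d_def)
    show "d x z \<le> d x y + d y z" if "x \<in> ?V" "y \<in> ?V" "z \<in> ?V" for x y z
    proof (cases "x \<rightarrow>\<^sup>* y \<and> y \<rightarrow>\<^sup>* z")
      case True
      then have xz: "x \<rightarrow>\<^sup>* z" using reachable_trans by blast
      have "ereal (?m x z) \<le> ereal (?m x y) + ereal (?m y z)"
        using mu_triangle[OF pos, of x y z] True xz
        by (simp add: mu_real[OF pos, symmetric])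
      then show ?thesis using True xz by (simp add: d_def)
    next
      case False
      have "d x z \<le> M" using m_less[OF that(1,3)] M by (auto simp: d_def)
      moreover have "0 \<le> d x y" "0 \<le> d y z" using that m_nonneg M by (auto simp: d_def)
      moreover have "d x y = M \<or> d y z = M" using False by (auto simp: d_def)
      ultimately show ?thesis by linarith
    qed
  qed
  have mu_d: "x \<rightarrow>\<^sup>* y \<and> \<mu> w x y = ereal (d x y)" if "d x y < M" for x y
    using that mu_real[OF pos, of x y] by (auto simp: d_def split: if_splits)
  have d_M: "d x y = M" if "\<not> x \<rightarrow>\<^sup>* y" for x y using that by (simp add: d_def)
  have d_less: "2 * d x y < M" if "x \<rightarrow>\<^sup>* y" "x \<in> ?V" "y \<in> ?V" for x y
    using that m_less by (simp add: d_def)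
  \<comment> \<open>The positions are distances from the start \<open>u\<close> of a shortest path
    through \<open>S\<close>. They are finite on \<open>S\<close>, so comparing their real values is
    the same as comparing the distances.\<close>
  have geo: "\<exists>f. geodesic d f S" if S: "S \<subseteq> ?V" "card S \<le> 6" for S
  proof -
    obtain u v p where p: "shortest_path w u p v" "S \<subseteq> path_nodes u p" using six[OF S] by blast
    have "u \<rightarrow>\<^sup>* x" if "x \<in> S" for x
      using p that awalk_verts_reachable_from[of u p v x]
      by (auto simp: shortest_path_def apath_def path_nodes_def)
    then have "\<mu> w u x = ereal (?m u x)" if "x \<in> S" for x using that mu_real[OF pos] by blast
    then have "\<mu> w u x \<le> \<mu> w u y" if "x \<in> S" "y \<in> S" "?m u x \<le> ?m u y" for x y
      using that by (metis ereal_less_eq(3))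
    then have "x \<rightarrow>\<^sup>* y \<and> \<mu> w x y = ereal (?m u y - ?m u x)"
      if "x \<in> S" "y \<in> S" "?m u x \<le> ?m u y" for x y
      using shortest_path_positions[OF pos p(1), of x y] p(2) that by blast
    then have "geodesic d (?m u) S" by (simp add: geodesic_def d_def)
    then show ?thesis by blast
  qed
  have total: "x \<rightarrow>\<^sup>* y \<or> y \<rightarrow>\<^sup>* x" if xy: "x \<in> ?V" "y \<in> ?V" for x y
  proof -
    have "card {x, y} \<le> 6" using card_length[of "[x, y]"] by simp
    then obtain u v p where p: "shortest_path w u p v" "{x, y} \<subseteq> path_nodes u p"
      using six[of "{x, y}"] xy by blast
    then show ?thesis using shortest_path_positions(1)[OF pos p(1)] by (meson insert_subset linear)
  qed
  have path: "\<exists>q. shortest_path w s q t \<and> A \<subseteq> path_nodes s q"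
    if "s \<in> A" "t \<in> A" "A \<subseteq> Q.between s t" "geodesic d (d s) A" "s \<rightarrow>\<^sup>* t" for s t A
  proof (rule shortest_path_through_geodesic[OF pos, where f = "d s"])
    show AV: "A \<subseteq> ?V" using that by (auto simp: Q.between_def)
    have V: "s \<in> ?V" "t \<in> ?V" using AV that by auto
    have bd: "0 \<le> d s x \<and> d s x \<le> d s t" if "x \<in> A" for x
    proof -
      have "x \<in> ?V" "d s x + d x t = d s t"
        using that \<open>A \<subseteq> Q.between s t\<close> by (auto simp: Q.between_def)
      then show ?thesis using Q.d_nonneg[of s x] Q.d_nonneg[of x t] V by linarith
    qed
    \<comment> \<open>All distances taken forward along \<open>A\<close> are at most
      \<open>d s t\<close>, hence below \<open>M\<close>, and so are genuine graph
      distances.\<close>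
    have "d s t < M" using d_less[OF \<open>s \<rightarrow>\<^sup>* t\<close> V] M by linarith
    then show "\<mu> w x y = ereal (d s y - d s x)" if "x \<in> A" "y \<in> A" "d s x \<le> d s y" for x y
      using mu_d[of x y] geodesicD[OF \<open>geodesic d (d s) A\<close> that] bd[OF that(1)] bd[OF that(2)]
      by auto
    show "d s s \<le> d s x \<and> d s x \<le> d s t" if "x \<in> A" for x using bd[OF that] Q.d_refl V by auto
  qed (use that in auto)
  obtain a b where "a \<in> ?V" "b \<in> ?V" "a \<noteq> b"
    using two by (metis One_nat_def card_le_Suc0_iff_eq finite_verts not_less_eq_eq numeral_2_eq_2)
  then obtain s t where st: "Q.antipodal s t" using Q.ex_antipodal by blast
  then have V: "s \<in> ?V" "t \<in> ?V" by (auto simp: Q.antipodal_def)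
  have one_way: "\<exists>p. shortest_path w s p t \<and> path_nodes s p = ?V"
    if st: "Q.antipodal s t" "\<not> t \<rightarrow>\<^sup>* s" for s t
  proof -
    have V: "s \<in> ?V" "t \<in> ?V" using st by (auto simp: Q.antipodal_def)
    obtain A B where AB: "A \<union> B = ?V" "{s, t} \<subseteq> A" "A \<subseteq> Q.between s t" "B \<subseteq> Q.between t s"
      "geodesic d (d s) A" using Q.geodesic_cover[OF st(1) geo] by metis
    \<comment> \<open>Since \<open>d t s = M\<close>, a further node between \<open>t\<close> and
      \<open>s\<close> would split \<open>M\<close> into two positive parts below \<open>M\<close>.
      Both legs would then be reachable, giving a path from \<open>t\<close> to
      \<open>s\<close>.\<close>
    have "B \<subseteq> {s, t}"
    proof
      fix x assume "x \<in> B"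
      then have x: "x \<in> ?V" "d t x + d x s = M"
        using AB(4) d_M[OF st(2)] by (auto simp: Q.between_def)
      show "x \<in> {s, t}"
      proof (rule ccontr)
        assume "x \<notin> {s, t}"
        then have "0 < d t x" "0 < d x s" using Q.d_pos x V by auto
        then have "d t x < M" "d x s < M" using x by linarith+
        then show False using mu_d st(2) reachable_trans by blast
      qed
    qed
    then have "A = ?V" using AB by blast
    moreover obtain p where "shortest_path w s p t" "A \<subseteq> path_nodes s p"
      using path[of s A t] AB total[OF V] st(2) by auto
    ultimately show ?thesis using path_nodes_subset by blast
  qed
  consider "s \<rightarrow>\<^sup>* t" "t \<rightarrow>\<^sup>* s" | "\<not> t \<rightarrow>\<^sup>* s" | "\<not> s \<rightarrow>\<^sup>* t" by blast
  then show ?thesis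
  proof cases
    case 1
    obtain A B where AB: "A \<union> B = ?V" "{s, t} \<subseteq> A" "{s, t} \<subseteq> B" "A \<subseteq> Q.between s t"
      "B \<subseteq> Q.between t s" "geodesic d (d s) A" "geodesic d (d t) B"
      using Q.geodesic_cover[OF st geo] by metis
    then obtain p q where "shortest_path w s p t" "A \<subseteq> path_nodes s p"
      "shortest_path w t q s" "B \<subseteq> path_nodes t q"
      using path[of s A t] path[of t B s] 1 by auto
    then show ?thesis using AB(1) path_nodes_subset V by blast
  next
    case 2
    then show ?thesis using one_way[OF st] V by blast
  next
    case 3
    then show ?thesis using one_way[OF Q.antipodal_sym[OF st]] V by blast
  qed
qed

end

text \<open>The second alternative covers graphs without a return path: a directed path on eleven
  nodes satisfies the hypotheses, but no pair of opposite paths covers it. With fewer than eleven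
  nodes the condition on sets would be vacuous.\<close>

theorem theorem1p3:
  fixes G :: "('a, 'b) pre_digraph" and w :: "'b \<Rightarrow> real"
  assumes "fin_digraph G"
    and "\<forall>e \<in> arcs G. 0 < w e"
    and "11 \<le> card (verts G)"
    and "\<forall>S. S \<subseteq> verts G \<and> card S = 11 \<longrightarrow>
           (\<exists>u v p. wf_digraph.shortest_path G w u p v \<and> S \<subseteq> wf_digraph.path_nodes G u p)"
  shows "\<exists>s \<in> verts G. \<exists>t \<in> verts G.
           (\<exists>p q. wf_digraph.shortest_path G w s p t \<and> wf_digraph.shortest_path G w t q s \<and>
                  wf_digraph.path_nodes G s p \<union> wf_digraph.path_nodes G t q = verts G) \<or>
           (\<not> t \<rightarrow>\<^sup>*\<^bsub>G\<^esub> s \<and>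
             (\<exists>p. wf_digraph.shortest_path G w s p t \<and> wf_digraph.path_nodes G s p = verts G))"
proof -
  interpret fin_digraph G by fact
  have "\<exists>u v p. shortest_path w u p v \<and> S \<subseteq> path_nodes u p"
    if S: "S \<subseteq> verts G" "card S \<le> 6" for S
  proof -
    \<comment> \<open>There are at least eleven nodes, so a smaller set can be enlarged to exactly
      eleven.\<close>
    obtain T where "S \<subseteq> T" "T \<subseteq> verts G" "card T = 11"
      using exists_subset_between[of S 11 "verts G"] S assms(3) by auto
    then show ?thesis using assms(4) by (meson order_trans)
  qed
  then show ?thesis using assms(2,3) by (intro covered_by_two_shortest_paths) auto
qed

end
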